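(* For every even $r=2t$ with $r\in\{10,18,20\}$ or $r\ge 28$, there exists a binary linear $[n,n-r,3]_2 2$ code with $n=26\cdot2^{r/2-4}-1$; hence $\ell_2(r,2)\le 26\cdot 2^{r/2-4}-1$ for these $r$. Moreover, for even $r\ge42$ the parity-check matrix of this code admits a $2$-partition into at most $2^{\lfloor r/4\rfloor-2}+1$ subsets, and the covering densities $\mu=2^{-r}\big(1+n+\binom n2\big)$ of the codes of this family tend to $26^2/2^9\approx1.3203$ as $r\to\infty$.
   Context: $[n,n-r,d]_2R$: binary linear code of length $n$, codimension $r$, minimum distance $d$, covering radius $R$ (smallest $R$ such that every vector of $\mathbb{F}_2^r$ is a sum of at most $R$ columns of a parity-check matrix). $\ell_2(r,R)$: smallest length of a binary linear code of codimension $r$ and covering radius $R$. A $2$-partition of an $r\times n$ parity-check matrix (covering radius $2$, minimum distance $\ge3$) is a partition of its columns into nonempty subsets such that every vector of $\mathbb{F}_2^r$ is the sum of at most $2$ columns lying in pairwise distinct subsets. *)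

theory Defs
  imports Complex_Main "HOL-Library.Z2"
begin

text \<open>Vectors of F_2^m are functions nat => bit vanishing outside {..<m}.
  A binary r x n parity-check matrix is H :: nat => nat => bit, entry H i j
  in row i < r, column j < n (entries outside the range are irrelevant).\<close>

definition vecs :: "nat \<Rightarrow> (nat \<Rightarrow> bit) set" where
  "vecs m = {v. \<forall>i\<ge>m. v i = 0}"

definition col :: "(nat \<Rightarrow> nat \<Rightarrow> bit) \<Rightarrow> nat \<Rightarrow> nat \<Rightarrow> (nat \<Rightarrow> bit)" where
  "col H r j = (\<lambda>i. if i < r then H i j else 0)"

definition colsum :: "(nat \<Rightarrow> nat \<Rightarrow> bit) \<Rightarrow> nat \<Rightarrow> nat set \<Rightarrow> (nat \<Rightarrow> bit)" where
  "colsum H r S = (\<lambda>i. \<Sum>j\<in>S. col H r j i)"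

definition code :: "(nat \<Rightarrow> nat \<Rightarrow> bit) \<Rightarrow> nat \<Rightarrow> nat \<Rightarrow> (nat \<Rightarrow> bit) set" where
  "code H r n = {x \<in> vecs n. \<forall>i<r. (\<Sum>j<n. H i j * x j) = 0}"

definition weight :: "nat \<Rightarrow> (nat \<Rightarrow> bit) \<Rightarrow> nat" where
  "weight n x = card {j. j < n \<and> x j \<noteq> 0}"

definition min_dist :: "(nat \<Rightarrow> nat \<Rightarrow> bit) \<Rightarrow> nat \<Rightarrow> nat \<Rightarrow> nat" where
  "min_dist H r n = (LEAST d. \<exists>x\<in>code H r n. x \<noteq> (\<lambda>_. 0) \<and> weight n x = d)"

definition cov_radius :: "(nat \<Rightarrow> nat \<Rightarrow> bit) \<Rightarrow> nat \<Rightarrow> nat \<Rightarrow> nat" where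
  "cov_radius H r n = (LEAST R. \<forall>v\<in>vecs r. \<exists>S\<subseteq>{..<n}. card S \<le> R \<and> v = colsum H r S)"

text \<open>H is a parity-check matrix of a binary linear code of length n and
  codimension r (i.e. the code has dimension n - r, i.e. 2^(n-r) codewords).\<close>
definition lin_code :: "(nat \<Rightarrow> nat \<Rightarrow> bit) \<Rightarrow> nat \<Rightarrow> nat \<Rightarrow> bool" where
  "lin_code H r n \<longleftrightarrow> r \<le> n \<and> card (code H r n) = 2 ^ (n - r)"

definition is_code :: "(nat \<Rightarrow> nat \<Rightarrow> bit) \<Rightarrow> nat \<Rightarrow> nat \<Rightarrow> nat \<Rightarrow> nat \<Rightarrow> bool" where
  "is_code H r n d R \<longleftrightarrow> lin_code H r n \<and> min_dist H r n = d \<and> cov_radius H r n = R"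

definition ell2 :: "nat \<Rightarrow> nat \<Rightarrow> nat" where
  "ell2 r R = (LEAST n. \<exists>H. lin_code H r n \<and> cov_radius H r n = R)"

definition two_partition :: "(nat \<Rightarrow> nat \<Rightarrow> bit) \<Rightarrow> nat \<Rightarrow> nat \<Rightarrow> nat set set \<Rightarrow> bool" where
  "two_partition H r n P \<longleftrightarrow>
     \<Union>P = {..<n} \<and> (\<forall>A\<in>P. A \<noteq> {}) \<and> (\<forall>A\<in>P. \<forall>B\<in>P. A \<noteq> B \<longrightarrow> A \<inter> B = {}) \<and>
     (\<forall>v\<in>vecs r. v = (\<lambda>_. 0)
        \<or> (\<exists>j<n. v = col H r j)
        \<or> (\<exists>A\<in>P. \<exists>B\<in>P. A \<noteq> B \<and> (\<exists>j\<in>A. \<exists>k\<in>B. v = colsum H r {j, k})))"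

end

theory Submission
  imports Defs "HOL-Library.Function_Algebras" "HOL-Algebra.Algebraic_Closure_Type"
begin

text \<open>
  Let the columns \<open>h\<close> of a code of codimension \<open>r\<close> be split into \<open>2^m\<close> classes labelled by the
  elements \<open>\<beta>\<close> of the field with \<open>2^m\<close> elements. The columns \<open>(h, x, \<beta> x)\<close> with \<open>x\<close> in the field and
  \<open>h\<close> in the class \<open>\<beta>\<close>, together with the columns \<open>(0, 0, y)\<close> with \<open>y \<noteq> 0\<close>, form a code of
  codimension \<open>r + 2 m\<close>. Its covering radius is again \<open>2\<close>: a sum of two columns from different
  classes leads to a regular linear system \<open>x + x' = u\<close>, \<open>\<beta> x + \<gamma> x' = w\<close>; a single column is
  corrected by one of the \<open>(0, 0, y)\<close>; and above the zero vector, \<open>(0, u, w)\<close> with \<open>u \<noteq> 0\<close> is the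
  difference of two columns over the same \<open>h\<close> in the class \<open>\<beta> = w / u\<close>, which is why every label has
  to occur. The length satisfies \<open>n + 1 \<mapsto> 2^m (n + 1)\<close>, so the family starts from a single code of
  length 51 and codimension 10 with a 2-partition into 16 subsets, which is given explicitly.
\<close>

section \<open>Binary vectors and a field structure on them\<close>

lemma add_self_vec: "v + v = (0 :: nat \<Rightarrow> bit)"
  by (auto simp: fun_eq_iff)

lemma add_eq_iff_vec: "u + v = w \<longleftrightarrow> u = w + (v :: nat \<Rightarrow> bit)"
  by (auto simp: add.assoc add_self_vec)

lemma zero_in_vecs [simp]: "0 \<in> vecs m"
  by (simp add: vecs_def)

lemma add_in_vecs [simp]: "u \<in> vecs m \<Longrightarrow> v \<in> vecs m \<Longrightarrow> u + v \<in> vecs m"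
  by (simp add: vecs_def)

lemma bij_betw_vecs: "bij_betw (\<lambda>v. {i. v i \<noteq> 0}) (vecs m) (Pow {..<m})"
proof (rule bij_betwI[where g = "\<lambda>A i. of_bool (i \<in> A)"])
  show "(\<lambda>v. {i. v i \<noteq> 0}) \<in> vecs m \<rightarrow> Pow {..<m}"
    by (auto simp: vecs_def not_le[symmetric])
  show "(\<lambda>A i. of_bool (i \<in> A)) \<in> Pow {..<m} \<rightarrow> vecs m"
    by (auto simp: vecs_def)
qed (simp_all add: fun_eq_iff)

lemma finite_vecs [simp]: "finite (vecs m)"
  using bij_betw_finite[OF bij_betw_vecs] by simp

lemma card_vecs: "card (vecs m) = 2 ^ m"
  using bij_betw_same_card[OF bij_betw_vecs] by (simp add: card_Pow)

definition join :: "nat \<Rightarrow> (nat \<Rightarrow> bit) \<Rightarrow> (nat \<Rightarrow> bit) \<Rightarrow> nat \<Rightarrow> bit" where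
  "join r v x = (\<lambda>i. if i < r then v i else x (i - r))"

lemma join_in_vecs: "x \<in> vecs m \<Longrightarrow> join r v x \<in> vecs (r + m)"
  by (auto simp: join_def vecs_def)

lemma join_add: "join r u x + join r v y = join r (u + v) (x + y)"
  by (auto simp: join_def)

lemma join_zero: "join r 0 0 = 0"
  by (auto simp: join_def)

lemma join_eq_iff:
  assumes "u \<in> vecs r" "v \<in> vecs r"
  shows "join r u x = join r v y \<longleftrightarrow> u = v \<and> x = y"
proof
  assume eq: "join r u x = join r v y"
  have "u i = v i" for i
    using fun_cong[OF eq, of i] assms by (cases "i < r") (auto simp: join_def vecs_def)
  moreover have "x i = y i" for i
    using fun_cong[OF eq, of "r + i"] by (simp add: join_def)
  ultimately show "u = v \<and> x = y" by blast
qed simp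

lemma vecs_joinE:
  assumes "w \<in> vecs (r + m)"
  obtains v x where "v \<in> vecs r" "x \<in> vecs m" "w = join r v x"
proof
  show "(\<lambda>i. if i < r then w i else 0) \<in> vecs r" "(\<lambda>i. w (r + i)) \<in> vecs m"
    using assms by (auto simp: vecs_def)
  show "w = join r (\<lambda>i. if i < r then w i else 0) (\<lambda>i. w (r + i))"
    by (auto simp: join_def)
qed

lemma elementary_abelian_2_group_iso_vecs:
  fixes F :: "'a :: ab_group_add set"
  assumes F: "finite F" "card F = 2 ^ m" "0 \<in> F"
    and add: "\<And>x y. x \<in> F \<Longrightarrow> y \<in> F \<Longrightarrow> x + y \<in> F"
    and char2: "\<And>x. x \<in> F \<Longrightarrow> x + x = 0"
  shows "\<exists>\<phi>. bij_betw \<phi> (vecs m) F \<and> (\<forall>u\<in>vecs m. \<forall>v\<in>vecs m. \<phi> (u + v) = \<phi> u + \<phi> v)"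
proof -
  have "\<exists>\<phi>. inj_on \<phi> (vecs k) \<and> \<phi> ` vecs k \<subseteq> F \<and>
          (\<forall>u\<in>vecs k. \<forall>v\<in>vecs k. \<phi> (u + v) = \<phi> u + \<phi> v)" if "k \<le> m" for k
    using that
  proof (induction k)
    case 0
    have "vecs 0 = {0}" by (auto simp: vecs_def)
    then show ?case using F by (intro exI[of _ "\<lambda>_. 0"]) auto
  next
    case (Suc k)
    then obtain \<phi> where inj: "inj_on \<phi> (vecs k)" and sub: "\<phi> ` vecs k \<subseteq> F"
      and hom: "\<And>u v. u \<in> vecs k \<Longrightarrow> v \<in> vecs k \<Longrightarrow> \<phi> (u + v) = \<phi> u + \<phi> v"
      by (metis Suc_leD)
    have "card (\<phi> ` vecs k) < card F"
      using Suc.prems by (simp add: card_image[OF inj] card_vecs F)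
    then obtain x where x: "x \<in> F" "x \<notin> \<phi> ` vecs k"
      using sub by (metis less_irrefl subsetI subset_antisym)
    have cut: "v(k := 0) \<in> vecs k" if "v \<in> vecs (Suc k)" for v
      using that by (auto simp: vecs_def le_Suc_eq)
    have cut_add: "(u + v)(k := 0) = u(k := 0) + v(k := 0)" for u v :: "nat \<Rightarrow> bit"
      by auto
    define \<psi> where "\<psi> v = \<phi> (v(k := 0)) + (if v k = 0 then 0 else x)" for v
    have in_F: "\<phi> (v(k := 0)) \<in> F" if "v \<in> vecs (Suc k)" for v
      using sub cut[OF that] by auto
    have "\<psi> (u + v) = \<psi> u + \<psi> v" if "u \<in> vecs (Suc k)" "v \<in> vecs (Suc k)" for u v
      using char2[OF x(1)] unfolding \<psi>_def cut_add hom[OF cut[OF that(1)] cut[OF that(2)]]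
      by (cases "u k"; cases "v k") (simp_all add: algebra_simps)
    moreover have "\<psi> ` vecs (Suc k) \<subseteq> F"
      using in_F x(1) add by (auto simp: \<psi>_def)
    moreover have "inj_on \<psi> (vecs (Suc k))"
    proof (rule inj_onI)
      fix u v assume uv: "u \<in> vecs (Suc k)" "v \<in> vecs (Suc k)" "\<psi> u = \<psi> v"
      have "u k = v k"
      proof (rule ccontr)
        assume neq: "u k \<noteq> v k"
        have "x = \<phi> (u(k := 0)) + \<phi> (v(k := 0))"
        proof (cases "u k = 0")
          case True
          with neq have "\<phi> (u(k := 0)) = \<phi> (v(k := 0)) + x"
            using uv(3) by (cases "v k") (simp_all add: \<psi>_def)
          then show ?thesis using char2[OF in_F[OF uv(2)]]
            by (metis add.assoc add.commute add_0)
        next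
          case False
          with neq have "\<phi> (u(k := 0)) + x = \<phi> (v(k := 0))"
            using uv(3) by (cases "v k") (simp_all add: \<psi>_def)
          then show ?thesis using char2[OF in_F[OF uv(1)]]
            by (metis add.assoc add_0)
        qed
        also have "\<dots> = \<phi> (u(k := 0) + v(k := 0))"
          using hom cut uv by metis
        also have "\<dots> \<in> \<phi> ` vecs k"
          using cut uv by (intro imageI add_in_vecs)
        finally show False using x by simp
      qed
      moreover from this have "u(k := 0) = v(k := 0)"
        using uv(3) inj cut[OF uv(1)] cut[OF uv(2)] by (auto simp: \<psi>_def inj_on_eq_iff)
      ultimately show "u = v"
        by (metis fun_upd_triv fun_upd_upd)
    qed
    ultimately show ?case by blast
  qed
  from this[of m] obtain \<phi> where "inj_on \<phi> (vecs m)" "\<phi> ` vecs m \<subseteq> F"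
    "\<forall>u\<in>vecs m. \<forall>v\<in>vecs m. \<phi> (u + v) = \<phi> u + \<phi> v" by auto
  then show ?thesis
    using F by (metis bij_betw_def card_image card_subset_eq card_vecs)
qed

lemma CHAR_bit: "CHAR(bit) = 2"
  by (rule CHAR_eqI) (metis bit_2_eq_0 of_nat_numeral, metis even_of_nat even_zero)

lemma card_frobenius_fixed_points:
  assumes "m > 0"
  shows "card {x :: bit alg_closure. x ^ 2 ^ m = x} = 2 ^ m"
proof -
  define q where "q = (2 :: nat) ^ m"
  have q: "q > 1" using assms one_less_power[of "2 :: nat" m] by (simp add: q_def)
  define p :: "bit alg_closure poly" where "p = monom 1 q - monom 1 1"
  have deg: "degree p = q"
    unfolding p_def using q by (subst diff_conv_add_uminus, subst degree_add_eq_left)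
      (auto simp: degree_monom_eq)
  have "p \<noteq> 0" using deg q by auto
  then obtain A where A: "size A = q" "p = smult (lead_coeff p) (\<Prod>x\<in>#A. [:-x, 1:])"
    using alg_closed_imp_factorization[of p] deg by auto
  have "of_nat q = (0 :: bit alg_closure)"
    using assms by (simp only: of_nat_eq_0_iff_char_dvd) (simp add: CHAR_bit q_def)
  then have pderiv: "pderiv p = -1"
    by (simp add: p_def pderiv_diff pderiv_monom)
  have root: "x \<in># A \<longleftrightarrow> x ^ q = x" for x
  proof -
    have "x \<in># A \<longleftrightarrow> poly p x = 0"
      using \<open>p \<noteq> 0\<close> by (subst A(2)) (auto simp: poly_prod_mset)
    also have "\<dots> \<longleftrightarrow> x ^ q = x" by (simp add: p_def poly_monom)
    finally show ?thesis .
  qed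
  have "count A x = 1" if x: "x \<in># A" for x
  proof (rule ccontr)
    assume "count A x \<noteq> 1"
    moreover have "count A x > 0" using x by simp
    ultimately have "2 \<le> count A x" by linarith
    then have "replicate_mset 2 x \<subseteq># A"
      by (simp add: count_le_replicate_mset_subset_eq[symmetric])
    then obtain B where "A = {#x, x#} + B"
      by (auto simp: mset_subset_eq_exists_conv numeral_2_eq_2)
    then have "p = [:-x, 1:] * ([:-x, 1:] * smult (lead_coeff p) (\<Prod>y\<in>#B. [:-y, 1:]))"
      by (subst A(2)) (simp add: mult_ac)
    then obtain c where c: "p = [:-x, 1:] * ([:-x, 1:] * c)" by blast
    have "poly (pderiv p) x = 0"
      unfolding c by (subst pderiv_mult) (simp del: mult_pCons_left)
    then show False using pderiv by simp
  qed
  then have "size A = card (set_mset A)"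
    by (simp add: size_multiset_overloaded_eq)
  also have "set_mset A = {x. x ^ q = x}" using root by auto
  finally show ?thesis using A(1) by (simp add: q_def)
qed

lemma ex_field_multiplication_on_vecs:
  assumes "m > 0"
  obtains f :: "(nat \<Rightarrow> bit) \<Rightarrow> (nat \<Rightarrow> bit) \<Rightarrow> (nat \<Rightarrow> bit)" where
    "\<forall>a\<in>vecs m. \<forall>x\<in>vecs m. f a x \<in> vecs m"
    "\<forall>a\<in>vecs m. \<forall>b\<in>vecs m. \<forall>x\<in>vecs m. f (a + b) x = f a x + f b x"
    "\<forall>a\<in>vecs m. \<forall>x\<in>vecs m. \<forall>y\<in>vecs m. f a (x + y) = f a x + f a y"
    "\<forall>a\<in>vecs m. \<forall>x\<in>vecs m. f a x = 0 \<longrightarrow> a = 0 \<or> x = 0"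
proof -
  let ?F = "{x :: bit alg_closure. x ^ 2 ^ m = x}"
  have char: "CHAR(bit alg_closure) = 2" by (simp add: CHAR_bit)
  have card: "card ?F = 2 ^ m" by (rule card_frobenius_fixed_points[OF assms])
  have frob: "(x + y) ^ 2 ^ m = x ^ 2 ^ m + y ^ 2 ^ m" for x y :: "bit alg_closure"
    by (rule freshmans_dream') (simp_all only: char two_is_prime_nat)
  have two: "x + x = 0" for x :: "bit alg_closure"
  proof -
    have "of_nat 2 = (0 :: bit alg_closure)" using char by (metis of_nat_CHAR)
    then show ?thesis by (metis mult_2 mult_zero_left of_nat_numeral)
  qed
  have "finite ?F" by (rule card_ge_0_finite) (simp add: card)
  moreover have "x + y \<in> ?F" if "x \<in> ?F" "y \<in> ?F" for x y
    using that by (simp add: frob)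
  ultimately obtain \<phi> where bij: "bij_betw \<phi> (vecs m) ?F"
    and hom: "\<And>u v. u \<in> vecs m \<Longrightarrow> v \<in> vecs m \<Longrightarrow> \<phi> (u + v) = \<phi> u + \<phi> v"
    using elementary_abelian_2_group_iso_vecs[OF _ card _ _ two] by (auto simp: power_0_left)
  define \<psi> where "\<psi> = inv_into (vecs m) \<phi>"
  have \<phi>: "\<phi> u \<in> ?F" if "u \<in> vecs m" for u using bij that by (auto simp: bij_betw_def)
  have \<psi>: "\<psi> x \<in> vecs m" "\<phi> (\<psi> x) = x" if "x \<in> ?F" for x
    using bij_betw_inv_into_right[OF bij that] bij_betwE[OF bij_betw_inv_into[OF bij]] that
    by (simp_all add: \<psi>_def)
  have \<psi>\<phi>: "\<psi> (\<phi> u) = u" if "u \<in> vecs m" for u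
    using bij_betw_inv_into_left[OF bij that] by (simp add: \<psi>_def)
  have \<psi>_add: "\<psi> (x + y) = \<psi> x + \<psi> y" if "x \<in> ?F" "y \<in> ?F" for x y
    using \<psi>\<phi>[OF add_in_vecs[OF \<psi>(1)[OF that(1)] \<psi>(1)[OF that(2)]]]
    unfolding hom[OF \<psi>(1)[OF that(1)] \<psi>(1)[OF that(2)]] \<psi>(2)[OF that(1)] \<psi>(2)[OF that(2)] .
  have mult: "\<phi> a * \<phi> x \<in> ?F" if "a \<in> vecs m" "x \<in> vecs m" for a x
    using \<phi>[OF that(1)] \<phi>[OF that(2)] by (simp add: power_mult_distrib)
  have "\<phi> 0 = \<phi> 0 + \<phi> 0" using hom[of 0 0] by simp
  then have zero: "\<phi> 0 = 0" unfolding two .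
  show ?thesis
  proof (rule that[of "\<lambda>a x. \<psi> (\<phi> a * \<phi> x)"]; intro ballI impI)
    fix a x assume ax: "a \<in> vecs m" "x \<in> vecs m"
    show "\<psi> (\<phi> a * \<phi> x) \<in> vecs m" by (rule \<psi>(1)[OF mult[OF ax]])
    show "a = 0 \<or> x = 0" if "\<psi> (\<phi> a * \<phi> x) = 0"
    proof -
      have "\<phi> a * \<phi> x = 0"
        using \<psi>(2)[OF mult[OF ax]] unfolding that zero by simp
      then have "\<phi> a = \<phi> 0 \<or> \<phi> x = \<phi> 0" unfolding zero by simp
      then show ?thesis
        using \<psi>\<phi>[OF ax(1)] \<psi>\<phi>[OF ax(2)] \<psi>\<phi>[OF zero_in_vecs] by metis
    qed
  next
    fix a b x assume "a \<in> vecs m" "b \<in> vecs m" "x \<in> vecs m"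
    then show "\<psi> (\<phi> (a + b) * \<phi> x) = \<psi> (\<phi> a * \<phi> x) + \<psi> (\<phi> b * \<phi> x)"
      by (simp only: hom distrib_right \<psi>_add[OF mult mult])
  next
    fix a x y assume "a \<in> vecs m" "x \<in> vecs m" "y \<in> vecs m"
    then show "\<psi> (\<phi> a * \<phi> (x + y)) = \<psi> (\<phi> a * \<phi> x) + \<psi> (\<phi> a * \<phi> y)"
      by (simp only: hom distrib_left \<psi>_add[OF mult mult])
  qed
qed

section \<open>The concatenating construction\<close>

text \<open>
  The colouring \<open>c\<close> encodes a 2-partition. The last conjunct makes the minimum distance \<open>3\<close>, and it
  saves one class in each application of the construction: with \<open>2^(m+1) + 1\<close> instead of \<open>2^(m+1)\<close>
  classes, codimension 18 would come with 33 classes and \<open>m = 5\<close> could not be used to reach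
  codimension 28.
\<close>
definition partitioned_covering :: "nat \<Rightarrow> nat \<Rightarrow> nat \<Rightarrow> bool" where
  "partitioned_covering r n p \<longleftrightarrow> (\<exists>S (c :: (nat \<Rightarrow> bit) \<Rightarrow> nat).
     S \<subseteq> vecs r - {0} \<and> card S = n \<and> card (c ` S) \<le> p \<and>
     (\<forall>v\<in>vecs r. v = 0 \<or> v \<in> S \<or> (\<exists>a\<in>S. \<exists>b\<in>S. c a \<noteq> c b \<and> v = a + b)) \<and>
     (\<exists>a\<in>S. \<exists>b\<in>S. c a \<noteq> c b \<and> a + b \<in> S))"

lemma partitioned_coveringI:
  fixes c :: "(nat \<Rightarrow> bit) \<Rightarrow> 'c"
  assumes S: "S \<subseteq> vecs r - {0}" "card S = n" "card (c ` S) \<le> p"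
    and cov: "\<And>v. v \<in> vecs r \<Longrightarrow> v \<noteq> 0 \<Longrightarrow> v \<notin> S \<Longrightarrow> \<exists>a\<in>S. \<exists>b\<in>S. c a \<noteq> c b \<and> v = a + b"
    and line: "\<exists>a\<in>S. \<exists>b\<in>S. c a \<noteq> c b \<and> a + b \<in> S"
  shows "partitioned_covering r n p"
proof -
  have "finite S" using S(1) finite_vecs finite_subset by blast
  then obtain h :: "'c \<Rightarrow> nat" where h: "inj_on h (c ` S)"
    using finite_imp_inj_to_nat_seg[of "c ` S"] by auto
  have eq: "h (c a) = h (c b) \<longleftrightarrow> c a = c b" if "a \<in> S" "b \<in> S" for a b
    using h that by (auto simp: inj_on_eq_iff)
  have "card ((h \<circ> c) ` S) \<le> p"
    using S(3) card_image[OF h] by (simp add: image_comp)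
  moreover have "\<exists>a\<in>S. \<exists>b\<in>S. (h \<circ> c) a \<noteq> (h \<circ> c) b \<and> v = a + b"
    if "v \<in> vecs r" "v \<noteq> 0" "v \<notin> S" for v
    using cov[OF that] eq by (metis comp_apply)
  moreover have "\<exists>a\<in>S. \<exists>b\<in>S. (h \<circ> c) a \<noteq> (h \<circ> c) b \<and> a + b \<in> S"
    using line eq by (metis comp_apply)
  ultimately show ?thesis
    unfolding partitioned_covering_def using S(1,2)
    by (intro exI[of _ S] exI[of _ "h \<circ> c"] conjI ballI) blast+
qed

lemma partitioned_coveringE:
  assumes "partitioned_covering r n p"
  obtains S and c :: "(nat \<Rightarrow> bit) \<Rightarrow> nat" where
    "S \<subseteq> vecs r - {0}" "card S = n" "card (c ` S) \<le> p"
    "\<forall>v\<in>vecs r. v = 0 \<or> v \<in> S \<or> (\<exists>a\<in>S. \<exists>b\<in>S. c a \<noteq> c b \<and> v = a + b)"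
    "\<exists>a\<in>S. \<exists>b\<in>S. c a \<noteq> c b \<and> a + b \<in> S"
  using assms unfolding partitioned_covering_def by (elim exE conjE)

lemma partitioned_covering_mono:
  assumes "partitioned_covering r n p" "p \<le> q"
  shows "partitioned_covering r n q"
proof -
  obtain S and c :: "(nat \<Rightarrow> bit) \<Rightarrow> nat" where
    "S \<subseteq> vecs r - {0}" "card S = n" "card (c ` S) \<le> p"
    "\<forall>v\<in>vecs r. v = 0 \<or> v \<in> S \<or> (\<exists>a\<in>S. \<exists>b\<in>S. c a \<noteq> c b \<and> v = a + b)"
    "\<exists>a\<in>S. \<exists>b\<in>S. c a \<noteq> c b \<and> a + b \<in> S"
    using assms(1) by (rule partitioned_coveringE)
  with assms(2) show ?thesis
    by (intro partitioned_coveringI[of S r n c q]) auto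
qed

lemma refine_colouring:
  fixes c :: "'a \<Rightarrow> 'b" and Y :: "'c set"
  assumes "finite S" "finite Y" "card (c ` S) \<le> card Y" "card Y \<le> card S"
  obtains c' where "c' ` S = Y" "\<And>x y. x \<in> S \<Longrightarrow> y \<in> S \<Longrightarrow> c x \<noteq> c y \<Longrightarrow> c' x \<noteq> c' y"
proof -
  obtain T where T: "T \<subseteq> S" "inj_on c T" "c ` T = c ` S"
    using subset_image_inj[of "c ` S" c S] by auto
  have "card T \<le> card Y" using T assms(3) by (metis card_image)
  then obtain U where U: "T \<subseteq> U" "U \<subseteq> S" "card U = card Y"
    using exists_subset_between[of T "card Y" S] T(1) assms by blast
  have "finite U" using U(2) assms(1) finite_subset by blast
  then obtain e where e: "bij_betw e U Y"
    using finite_same_card_bij U(3) assms(2) by blast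
  define g where "g x = (if x \<in> U then x else inv_into T c (c x))" for x
  have g: "g x \<in> U" "c (g x) = c x" if "x \<in> S" for x
    using that T(3) U(1) unfolding g_def
    by (auto simp: inv_into_into f_inv_into_f subset_iff)
  show ?thesis
  proof
    have "g ` S = U" using g U(2) by (force simp: g_def)
    then show "(\<lambda>x. e (g x)) ` S = Y"
      using e by (metis bij_betw_imp_surj_on image_image)
  next
    fix x y assume "x \<in> S" "y \<in> S" "c x \<noteq> c y"
    then have "g x \<noteq> g y" using g by metis
    then show "e (g x) \<noteq> e (g y)"
      using g \<open>x \<in> S\<close> \<open>y \<in> S\<close> e by (metis bij_betw_inv_into_left)
  qed
qed

lemma partitioned_covering_concatenation:
  assumes Q: "partitioned_covering r n p" and m: "m > 0" "p \<le> 2 ^ m" "2 ^ m \<le> n"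
  shows "partitioned_covering (r + 2 * m) (n * 2 ^ m + 2 ^ m - 1) (2 ^ (m + 1))"
proof -
  obtain S and c0 :: "(nat \<Rightarrow> bit) \<Rightarrow> nat" where S: "S \<subseteq> vecs r - {0}" "card S = n"
    and c0: "card (c0 ` S) \<le> p"
    and cov0: "\<forall>v\<in>vecs r. v = 0 \<or> v \<in> S \<or> (\<exists>a\<in>S. \<exists>b\<in>S. c0 a \<noteq> c0 b \<and> v = a + b)"
    and line0: "\<exists>a\<in>S. \<exists>b\<in>S. c0 a \<noteq> c0 b \<and> a + b \<in> S"
    using Q by (rule partitioned_coveringE)
  have fin: "finite S" using S(1) finite_vecs finite_subset by blast
  let ?F = "vecs m"
  obtain c where c: "c ` S = ?F"
    and refine: "\<And>x y. x \<in> S \<Longrightarrow> y \<in> S \<Longrightarrow> c0 x \<noteq> c0 y \<Longrightarrow> c x \<noteq> c y"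
    using refine_colouring[OF fin finite_vecs[of m], of c0] c0 m S(2) by (auto simp: card_vecs)
  have cF: "c s \<in> ?F" if "s \<in> S" for s using c that by blast
  have cov: "\<exists>a\<in>S. \<exists>b\<in>S. c a \<noteq> c b \<and> v = a + b" if "v \<in> vecs r" "v \<noteq> 0" "v \<notin> S" for v
    using cov0 that refine by metis
  obtain a0 b0 where ab: "a0 \<in> S" "b0 \<in> S" "c a0 \<noteq> c b0" "a0 + b0 \<in> S"
    using line0 refine by metis
  obtain f where f': "\<forall>a\<in>?F. \<forall>x\<in>?F. f a x \<in> ?F"
    "\<forall>a\<in>?F. \<forall>b\<in>?F. \<forall>x\<in>?F. f (a + b) x = f a x + f b x"
    "\<forall>a\<in>?F. \<forall>x\<in>?F. \<forall>y\<in>?F. f a (x + y) = f a x + f a y"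
    "\<forall>a\<in>?F. \<forall>x\<in>?F. f a x = 0 \<longrightarrow> a = 0 \<or> x = 0"
    using m(1) by (rule ex_field_multiplication_on_vecs)
  have f: "f a x \<in> ?F" if "a \<in> ?F" "x \<in> ?F" for a x
    using f'(1) that by blast
  have f_add_left: "f (a + b) x = f a x + f b x" if "a \<in> ?F" "b \<in> ?F" "x \<in> ?F" for a b x
    using f'(2) that by blast
  have f_add: "f a (x + y) = f a x + f a y" if "a \<in> ?F" "x \<in> ?F" "y \<in> ?F" for a x y
    using f'(3) that by blast
  have f_zero: "a = 0 \<or> x = 0" if "a \<in> ?F" "x \<in> ?F" "f a x = 0" for a x
    using f'(4) that by blast
  have f0: "f a 0 = 0" if "a \<in> ?F" for a
    using f_add[OF that, of 0 0] by simp
  have div_left: "\<exists>a\<in>?F. f a x = y" if "x \<in> ?F" "x \<noteq> 0" "y \<in> ?F" for x y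
  proof -
    have "inj_on (\<lambda>a. f a x) ?F"
    proof (rule inj_onI)
      fix a b assume "a \<in> ?F" "b \<in> ?F" "f a x = f b x"
      then have "f (a + b) x = 0" using f_add_left that(1) add_self_vec by metis
      then have "a + b = 0" using f_zero \<open>a \<in> ?F\<close> \<open>b \<in> ?F\<close> that by (meson add_in_vecs)
      then show "a = b" by (simp add: add_eq_iff_vec)
    qed
    then have "(\<lambda>a. f a x) ` ?F = ?F"
      using f that(1) by (intro endo_inj_surj) auto
    then show ?thesis using that(3) by (metis imageE)
  qed
  have div_right: "\<exists>x\<in>?F. f a x = y" if "a \<in> ?F" "a \<noteq> 0" "y \<in> ?F" for a y
  proof -
    have "inj_on (f a) ?F"
    proof (rule inj_onI)
      fix x z assume "x \<in> ?F" "z \<in> ?F" "f a x = f a z"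
      then have "f a (x + z) = 0" using f_add that(1) add_self_vec by metis
      then have "x + z = 0" using f_zero \<open>x \<in> ?F\<close> \<open>z \<in> ?F\<close> that by (meson add_in_vecs)
      then show "x = z" by (simp add: add_eq_iff_vec)
    qed
    then have "f a ` ?F = ?F" using f that(1) by (intro endo_inj_surj) auto
    then show ?thesis using that(3) by (metis imageE)
  qed

  define t where "t v x y = join r v (join m x y)" for v x y :: "nat \<Rightarrow> bit"
  have t_add: "t v x y + t v' x' y' = t (v + v') (x + x') (y + y')" for v x y v' x' y'
    by (simp add: t_def join_add)
  have t_eq: "t v x y = t v' x' y' \<longleftrightarrow> v = v' \<and> x = x' \<and> y = y'"
    if "v \<in> vecs r" "v' \<in> vecs r" "x \<in> ?F" "x' \<in> ?F" for v x y v' x' y'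
    using that by (simp add: t_def join_eq_iff)
  have t_zero: "t 0 0 0 = 0" by (simp add: t_def join_zero)
  have t_in: "t v x y \<in> vecs (r + 2 * m)" if "y \<in> ?F" for v x y
    using join_in_vecs[OF join_in_vecs[OF that]] by (simp add: t_def mult_2)
  have Sr: "s \<in> vecs r" "s \<noteq> 0" if "s \<in> S" for s using S(1) that by auto

  define A where "A = (\<lambda>(s, x). t s x (f (c s) x)) ` (S \<times> ?F)"
  define B where "B = t 0 0 ` (?F - {0})"
  have A_I: "t s x (f (c s) x) \<in> A" if "s \<in> S" "x \<in> ?F" for s x
    using that by (auto simp: A_def)
  have B_I: "t 0 0 y \<in> B" if "y \<in> ?F" "y \<noteq> 0" for y
    using that by (auto simp: B_def)
  have "card A = n * 2 ^ m"
  proof -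
    have "inj_on (\<lambda>(s, x). t s x (f (c s) x)) (S \<times> ?F)"
      using Sr by (auto simp: inj_on_def t_eq)
    then show ?thesis
      unfolding A_def by (simp add: card_image card_cartesian_product card_vecs S(2))
  qed
  moreover have "card B = 2 ^ m - 1"
  proof -
    have "inj_on (t 0 0) (?F - {0})" by (auto simp: inj_on_def t_eq)
    then show ?thesis unfolding B_def by (simp add: card_image card_vecs)
  qed
  moreover have "A \<inter> B = {}"
    using Sr by (auto simp: A_def B_def t_eq)
  moreover have "finite A" "finite B" using fin by (auto simp: A_def B_def)
  ultimately have card: "card (A \<union> B) = n * 2 ^ m + 2 ^ m - 1"
    by (simp add: card_Un_disjoint)
  have "t v x y = 0 \<longleftrightarrow> v = 0 \<and> x = 0 \<and> y = 0" if "v \<in> vecs r" "x \<in> ?F" for v x y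
    using t_eq[of v 0 x 0 y 0] that by (simp add: t_zero)
  then have "0 \<notin> A \<union> B"
    using Sr by (auto simp: A_def B_def dest!: sym[of 0])
  moreover have "A \<union> B \<subseteq> vecs (r + 2 * m)"
    using f cF by (auto simp: A_def B_def intro!: t_in)
  ultimately have sub: "A \<union> B \<subseteq> vecs (r + 2 * m) - {0}" by blast

  text \<open>
    Above each label, the column with \<open>x = 0\<close> over one representative is put into a class of its own,
    so that the two columns used for \<open>(0, u, w)\<close> are separated. The special classes of the labels of
    \<open>a0\<close> and \<open>b0\<close> can be merged, because \<open>a0 + b0\<close> is a column and hence covered in another way.
  \<close>
  define rep where "rep \<beta> = (if \<beta> = c a0 then a0 else if \<beta> = c b0 then b0 else inv_into S c \<beta>)" for \<beta>
  have rep: "rep \<beta> \<in> S" "c (rep \<beta>) = \<beta>" if "\<beta> \<in> ?F" for \<beta>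
    using that ab unfolding rep_def c[symmetric] by (auto simp: inv_into_into f_inv_into_f)
  define C where "C s x = (if s = rep (c s) \<and> x = 0 then (if c s = c b0 then c a0 else c s, True)
    else (c s, False))" for s x :: "nat \<Rightarrow> bit"
  define d where "d w = (if w \<in> B then None else
    (let (s, x) = inv_into (S \<times> ?F) (\<lambda>(s, x). t s x (f (c s) x)) w in Some (C s x)))" for w
  have d_B: "d w = None" if "w \<in> B" for w using that by (simp add: d_def)
  have d_A: "d (t s x (f (c s) x)) = Some (C s x)" if "s \<in> S" "x \<in> ?F" for s x
  proof -
    have "inj_on (\<lambda>(s, x). t s x (f (c s) x)) (S \<times> ?F)"
      using Sr by (auto simp: inj_on_def t_eq)
    from inv_into_f_f[OF this, of "(s, x)"] show ?thesis
      using that A_I[OF that] \<open>A \<inter> B = {}\<close> by (auto simp: d_def)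
  qed
  have "d ` (A \<union> B) \<subseteq> insert None (Some ` (?F \<times> UNIV - {(c b0, True)}))"
    using cF ab by (auto simp: A_def d_A d_B C_def)
  then have "card (d ` (A \<union> B)) \<le> card (insert None (Some ` (?F \<times> UNIV - {(c b0, True)})))"
    by (intro card_mono) auto
  also have "\<dots> = Suc (card (?F \<times> (UNIV :: bool set) - {(c b0, True)}))"
    by (subst card_insert_disjoint) (auto simp: card_image)
  also have "\<dots> = 2 ^ (m + 1)"
    using cF[OF ab(2)] by (simp add: card_cartesian_product card_vecs)
  finally have colours: "card (d ` (A \<union> B)) \<le> 2 ^ (m + 1)" .

  have C_cross: "C a x \<noteq> C b y"
    if "a \<in> S" "b \<in> S" "c a \<noteq> c b" "a + b \<notin> S" for a b x y
  proof
    assume "C a x = C b y"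
    with that(3) have "a = rep (c a)" "b = rep (c b)" "{c a, c b} = {c a0, c b0}"
      by (auto simp: C_def split: if_splits)
    then have "{a, b} = {a0, b0}" using ab(3) by (auto simp: rep_def doubleton_eq_iff split: if_splits)
    then show False using that(4) ab(4) by (auto simp: doubleton_eq_iff add.commute)
  qed
  have "\<exists>u\<in>A \<union> B. \<exists>w\<in>A \<union> B. d u \<noteq> d w \<and> z = u + w"
    if z: "z \<in> vecs (r + 2 * m)" "z \<noteq> 0" "z \<notin> A \<union> B" for z
  proof -
    from z(1) have "z \<in> vecs (r + (m + m))" by (simp add: mult_2)
    then obtain v x y where v: "v \<in> vecs r" and x: "x \<in> ?F" and y: "y \<in> ?F" and z_eq: "z = t v x y"
      unfolding t_def by (metis vecs_joinE)
    consider "v = 0" | "v \<in> S" | "v \<noteq> 0" "v \<notin> S" by blast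
    then show ?thesis
    proof cases
      case 1
      have "x \<noteq> 0"
        using z(2,3) B_I[OF y] z_eq 1 t_zero by auto
      then obtain \<beta> where \<beta>: "\<beta> \<in> ?F" "f \<beta> x = y" using div_left x y by blast
      define s where "s = rep \<beta>"
      have s: "s \<in> S" "c s = \<beta>" using rep[OF \<beta>(1)] by (simp_all add: s_def)
      have "z = t s 0 (f (c s) 0) + t s x (f (c s) x)"
        by (simp add: t_add f0 cF s \<beta> add_self_vec z_eq 1)
      moreover have "d (t s 0 (f (c s) 0)) \<noteq> d (t s x (f (c s) x))"
        unfolding d_A[OF s(1) zero_in_vecs] d_A[OF s(1) x]
        using s \<open>x \<noteq> 0\<close> by (simp add: C_def s_def)
      ultimately show ?thesis
        using A_I[OF s(1) zero_in_vecs] A_I[OF s(1) x] by blast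
    next
      case 2
      have "z = t v x (f (c v) x) + t 0 0 (f (c v) x + y)"
        by (simp add: t_add z_eq add_self_vec flip: add.assoc)
      moreover from this have "f (c v) x + y \<noteq> 0"
        using z(3) A_I[OF 2 x] t_zero by auto
      then have "t 0 0 (f (c v) x + y) \<in> B"
        using f[OF cF[OF 2] x] y by (intro B_I) auto
      ultimately show ?thesis
        using A_I[OF 2 x] d_A[OF 2 x] d_B by (metis UnI1 UnI2 option.distinct(1))
    next
      case 3
      then obtain a b where ab: "a \<in> S" "b \<in> S" "c a \<noteq> c b" "v = a + b"
        using cov v by blast
      have "c a + c b \<noteq> 0" using ab(3) by (simp add: add_eq_iff_vec)
      then obtain x1 where x1: "x1 \<in> ?F" "f (c a + c b) x1 = y + f (c b) x"
        using div_right[of "c a + c b" "y + f (c b) x"] cF ab f x y by auto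
      have "f (c a) x1 + f (c b) (x1 + x) = f (c a + c b) x1 + f (c b) x"
        using x1(1) x cF ab by (simp add: f_add f_add_left add.assoc)
      also have "\<dots> = y" using x1(2) by (simp add: add.assoc add_self_vec)
      finally have "z = t a x1 (f (c a) x1) + t b (x1 + x) (f (c b) (x1 + x))"
        by (simp add: t_add z_eq ab(4) add_self_vec flip: add.assoc)
      moreover have "C a x1 \<noteq> C b (x1 + x)"
        using ab 3(2) by (intro C_cross) auto
      ultimately show ?thesis
        using ab x1(1) x A_I d_A by (metis UnI1 add_in_vecs option.inject)
    qed
  qed
  moreover have "\<exists>u\<in>A \<union> B. \<exists>w\<in>A \<union> B. d u \<noteq> d w \<and> u + w \<in> A \<union> B"
  proof -
    have A0: "t s 0 0 \<in> A" "d (t s 0 0) = Some (C s 0)" if "s \<in> S" for s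
      using A_I[OF that, of 0] d_A[OF that, of 0] f0 cF that by auto
    let ?k = "a0 + b0"
    have "?k \<noteq> a0" "?k \<noteq> b0" using Sr ab by auto
    then have "C a0 0 \<noteq> C ?k 0" using ab(3) by (auto simp: C_def rep_def split: if_splits)
    moreover have "t a0 0 0 + t ?k 0 0 = t b0 0 0"
      by (simp add: t_add add_self_vec flip: add.assoc)
    ultimately show ?thesis using A0 ab by (metis UnI1 option.inject)
  qed
  ultimately show ?thesis
    using sub card colours by (intro partitioned_coveringI[where c = d and S = "A \<union> B"])
qed

section \<open>From point sets to parity-check matrices\<close>

lemma colsum_eq_sum: "colsum H r A = (\<Sum>j\<in>A. col H r j)"
  by (induction A rule: infinite_finite_induct) (auto simp: colsum_def fun_eq_iff)

lemma colsum_in_vecs: "colsum H r A \<in> vecs r"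
  by (auto simp: colsum_def col_def vecs_def)

lemma syndrome_eq_colsum:
  assumes "i < r"
  shows "(\<Sum>j<n. H i j * x j) = colsum H r {j. j < n \<and> x j \<noteq> 0} i"
proof -
  have "(\<Sum>j<n. H i j * x j) = (\<Sum>j\<in>{j. j < n \<and> x j \<noteq> 0}. H i j * x j)"
    by (rule sum.mono_neutral_right) auto
  also have "\<dots> = colsum H r {j. j < n \<and> x j \<noteq> 0} i"
    using assms unfolding colsum_def col_def by (intro sum.cong) auto
  finally show ?thesis .
qed

lemma code_eq: "code H r n = {x \<in> vecs n. colsum H r {j. j < n \<and> x j \<noteq> 0} = 0}"
proof -
  have "(\<forall>i<r. (\<Sum>j<n. H i j * x j) = 0) \<longleftrightarrow> colsum H r {j. j < n \<and> x j \<noteq> 0} = 0" for x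
  proof -
    have "(\<forall>i<r. (\<Sum>j<n. H i j * x j) = 0) \<longleftrightarrow> (\<forall>i<r. colsum H r {j. j < n \<and> x j \<noteq> 0} i = 0)"
      by (intro all_cong1 imp_cong refl) (simp only: syndrome_eq_colsum)
    also have "\<dots> \<longleftrightarrow> (\<forall>i. colsum H r {j. j < n \<and> x j \<noteq> 0} i = 0)"
      using colsum_in_vecs[of H r] by (auto simp: vecs_def) (metis not_le)
    finally show ?thesis by (simp add: fun_eq_iff)
  qed
  then show ?thesis by (auto simp: code_def)
qed

lemma card_kernel_vecs:
  assumes f: "f ` vecs n = vecs r"
    and add: "\<And>x y. x \<in> vecs n \<Longrightarrow> y \<in> vecs n \<Longrightarrow> f (x + y) = f x + f y"
  shows "card {x \<in> vecs n. f x = 0} * 2 ^ r = 2 ^ n"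
proof -
  define g where "g = inv_into (vecs n) f"
  have g: "g v \<in> vecs n" "f (g v) = v" if "v \<in> vecs r" for v
    using that f by (auto simp: g_def inv_into_into f_inv_into_f)
  have fx: "f x \<in> vecs r" if "x \<in> vecs n" for x using f that by blast
  have "bij_betw (\<lambda>(k, v). k + g v) ({x \<in> vecs n. f x = 0} \<times> vecs r) (vecs n)"
  proof (rule bij_betwI[where g = "\<lambda>x. (x + g (f x), f x)"])
    show "(\<lambda>(k, v). k + g v) \<in> {x \<in> vecs n. f x = 0} \<times> vecs r \<rightarrow> vecs n"
      using g by auto
    show "(\<lambda>x. (x + g (f x), f x)) \<in> vecs n \<rightarrow> {x \<in> vecs n. f x = 0} \<times> vecs r"
      using g fx by (auto simp: add add_self_vec)
    show "(\<lambda>x. (x + g (f x), f x)) ((\<lambda>(k, v). k + g v) p) = p"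
      if "p \<in> {x \<in> vecs n. f x = 0} \<times> vecs r" for p
      using that g by (auto simp: add add.assoc add_self_vec)
    show "(\<lambda>(k, v). k + g v) ((\<lambda>x. (x + g (f x), f x)) x) = x" if "x \<in> vecs n" for x
      by (simp add: add.assoc add_self_vec)
  qed
  from bij_betw_same_card[OF this] show ?thesis
    by (simp add: card_cartesian_product card_vecs)
qed

lemma lin_code_if_covering:
  assumes "\<forall>v\<in>vecs r. \<exists>A\<subseteq>{..<n}. v = colsum H r A"
  shows "lin_code H r n"
proof -
  define f where "f x = (\<lambda>i. if i < r then \<Sum>j<n. H i j * x j else 0)" for x :: "nat \<Rightarrow> bit"
  have f_eq: "f x = colsum H r {j. j < n \<and> x j \<noteq> 0}" for x
  proof
    show "f x i = colsum H r {j. j < n \<and> x j \<noteq> 0} i" for i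
      using colsum_in_vecs[of H r "{j. j < n \<and> x j \<noteq> 0}"]
      unfolding f_def by (cases "i < r") (simp_all only: syndrome_eq_colsum if_True, simp add: vecs_def)
  qed
  have "v \<in> f ` vecs n" if v: "v \<in> vecs r" for v
  proof -
    obtain A where A: "A \<subseteq> {..<n}" "v = colsum H r A" using assms v by blast
    have "{j. j < n \<and> of_bool (j \<in> A) \<noteq> (0 :: bit)} = A" using A(1) by auto
    then have "v = f (\<lambda>j. of_bool (j \<in> A))" using A(2) by (simp only: f_eq)
    moreover have "(\<lambda>j. of_bool (j \<in> A)) \<in> vecs n" using A(1) by (auto simp: vecs_def)
    ultimately show ?thesis by blast
  qed
  then have "f ` vecs n = vecs r" using f_eq colsum_in_vecs by auto
  moreover have "f (x + y) = f x + f y" for x y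
  proof
    show "f (x + y) i = (f x + f y) i" for i
      by (cases "i < r") (simp_all only: f_def plus_fun_apply distrib_left sum.distrib if_True if_False add_0)
  qed
  ultimately have kernel: "card {x \<in> vecs n. f x = 0} * 2 ^ r = 2 ^ n"
    by (rule card_kernel_vecs)
  have "{x \<in> vecs n. f x = 0} = code H r n" by (simp only: code_eq f_eq)
  with kernel have card: "card (code H r n) * 2 ^ r = 2 ^ n" by simp
  then have "(2 :: nat) ^ r dvd 2 ^ n" by (metis dvd_triv_right)
  then have "r \<le> n" by (simp add: dvd_power_iff_le)
  moreover from this card have "card (code H r n) * 2 ^ r = 2 ^ (n - r) * 2 ^ r"
    by (simp flip: power_add)
  ultimately show ?thesis by (simp add: lin_code_def)
qed

lemma code_if_partitioned_covering:
  assumes "partitioned_covering r n p" "n + 1 < 2 ^ r"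
  shows "\<exists>H. is_code H r n 3 2 \<and> (\<exists>P. two_partition H r n P \<and> card P \<le> p)"
proof -
  obtain S and c :: "(nat \<Rightarrow> bit) \<Rightarrow> nat" where S: "S \<subseteq> vecs r - {0}" "card S = n"
    and colours: "card (c ` S) \<le> p"
    and cov: "\<forall>v\<in>vecs r. v = 0 \<or> v \<in> S \<or> (\<exists>a\<in>S. \<exists>b\<in>S. c a \<noteq> c b \<and> v = a + b)"
    and line: "\<exists>a\<in>S. \<exists>b\<in>S. c a \<noteq> c b \<and> a + b \<in> S"
    using assms(1) by (rule partitioned_coveringE)
  have "finite S" using S(1) finite_vecs finite_subset by blast
  then obtain e where e: "bij_betw e {..<n} S"
    using ex_bij_betw_nat_finite[of S] S(2) by (auto simp: atLeast0LessThan)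
  define H where "H i j = e j i" for i j
  have e_S: "e j \<in> S" if "j < n" for j using e that by (auto simp: bij_betw_def)
  have e_vec: "e j \<in> vecs r" "e j \<noteq> 0" if "j < n" for j using e_S[OF that] S(1) by auto
  have e_inj: "e j = e k \<longleftrightarrow> j = k" if "j < n" "k < n" for j k
    using e that by (auto simp: bij_betw_def inj_on_eq_iff)
  have S_e: "\<exists>j<n. s = e j" if "s \<in> S" for s
    using e that by (auto simp: bij_betw_def)
  have col: "col H r j = e j" if "j < n" for j
    using e_vec[OF that] by (auto simp: col_def H_def vecs_def fun_eq_iff)
  have pair: "colsum H r {j, k} = e j + e k" if "j < n" "k < n" "j \<noteq> k" for j k
    using that by (simp add: colsum_eq_sum col)

  have cov2: "\<exists>A\<subseteq>{..<n}. card A \<le> 2 \<and> v = colsum H r A" if v: "v \<in> vecs r" for v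
  proof -
    consider "v = 0" | "v \<in> S" | "\<exists>a\<in>S. \<exists>b\<in>S. c a \<noteq> c b \<and> v = a + b" using cov v by blast
    then show ?thesis
    proof cases
      case 1
      then show ?thesis by (intro exI[of _ "{}"]) (simp add: colsum_eq_sum)
    next
      case 2
      then obtain j where "j < n" "v = e j" using S_e by blast
      then show ?thesis by (intro exI[of _ "{j}"]) (simp add: colsum_eq_sum col)
    next
      case 3
      then obtain j k where "j < n" "k < n" "c (e j) \<noteq> c (e k)" "v = e j + e k" using S_e by metis
      then show ?thesis by (intro exI[of _ "{j, k}"]) (auto simp: pair card_insert_if)
    qed
  qed
  then have lin: "lin_code H r n" by (meson lin_code_if_covering)

  have "\<not> (\<forall>v\<in>vecs r. \<exists>A\<subseteq>{..<n}. card A \<le> R \<and> v = colsum H r A)" if "R < 2" for R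
  proof
    assume *: "\<forall>v\<in>vecs r. \<exists>A\<subseteq>{..<n}. card A \<le> R \<and> v = colsum H r A"
    have "v \<in> insert 0 S" if "v \<in> vecs r" for v
    proof -
      obtain A where A: "A \<subseteq> {..<n}" "card A \<le> R" "v = colsum H r A" using * \<open>v \<in> vecs r\<close> by blast
      then have "card A = 0 \<or> card A = 1" using \<open>R < 2\<close> by linarith
      moreover have "finite A" using A(1) finite_subset by blast
      ultimately have "A = {} \<or> (\<exists>j. A = {j})" by (auto simp: card_1_singleton_iff)
      then show ?thesis using A e_S by (auto simp: colsum_eq_sum col)
    qed
    then have "card (vecs r) \<le> card (insert 0 S)"
      using \<open>finite S\<close> by (intro card_mono) auto
    also have "\<dots> \<le> n + 1" using S(2) card_insert_le_m1[of "n + 1" S 0] by simp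
    finally show False using assms(2) by (simp add: card_vecs)
  qed
  then have radius: "cov_radius H r n = 2"
    unfolding cov_radius_def using cov2 by (intro Least_equality) (blast, metis not_le)

  have "min_dist H r n = 3"
    unfolding min_dist_def
  proof (rule Least_equality)
    obtain i j k where ijk: "i < n" "j < n" "k < n" "c (e i) \<noteq> c (e j)" "e i + e j = e k"
      using line S_e by metis
    then have "i \<noteq> j" by blast
    moreover have "i \<noteq> k" "j \<noteq> k" using ijk e_vec by auto
    ultimately have dist: "card {i, j, k} = 3" "colsum H r {i, j, k} = 0"
      using ijk by (auto simp: colsum_eq_sum col add_self_vec simp flip: add.assoc)
    define x where "x l = (of_bool (l \<in> {i, j, k}) :: bit)" for l
    have supp: "{l. l < n \<and> x l \<noteq> 0} = {i, j, k}"
      using ijk by (auto simp: x_def)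
    have "x \<in> vecs n" using ijk by (auto simp: vecs_def x_def)
    then have "x \<in> code H r n" unfolding code_eq mem_Collect_eq supp using dist by blast
    moreover have "x i = 1" by (simp add: x_def)
    then have "x \<noteq> (\<lambda>_. 0)" by auto
    moreover have "weight n x = 3" unfolding weight_def supp using dist by blast
    ultimately show "\<exists>x\<in>code H r n. x \<noteq> (\<lambda>_. 0) \<and> weight n x = 3" by blast
  next
    fix d assume "\<exists>x\<in>code H r n. x \<noteq> (\<lambda>_. 0) \<and> weight n x = d"
    then obtain x where x: "x \<in> code H r n" "x \<noteq> (\<lambda>_. 0)" "weight n x = d" by blast
    define A where "A = {j. j < n \<and> x j \<noteq> 0}"
    have A: "A \<subseteq> {..<n}" "colsum H r A = 0" "card A = d"
      using x by (auto simp: A_def code_eq weight_def)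
    have "finite A" using A(1) finite_subset by blast
    show "3 \<le> d"
    proof (rule ccontr)
      assume "\<not> 3 \<le> d"
      then consider "card A = 0" | "card A = 1" | "card A = 2" using A(3) by linarith
      then show False
      proof cases
        case 1
        then have "x j = 0" for j
          using \<open>finite A\<close> x(1) by (cases "j < n") (auto simp: A_def code_def vecs_def)
        then show False using x(2) by blast
      next
        case 2
        then obtain j where "A = {j}" by (auto simp: card_1_singleton_iff)
        then show False using A e_vec by (auto simp: colsum_eq_sum col)
      next
        case 3
        then obtain j k where "A = {j, k}" "j \<noteq> k" by (auto simp: card_2_iff)
        then have "j < n" "k < n" "e j + e k = 0" using A pair by auto
        then show False using e_inj \<open>j \<noteq> k\<close> by (simp add: add_eq_iff_vec)
      qed
    qed
  qed
  with lin radius have code: "is_code H r n 3 2" by (simp add: is_code_def)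

  define K where "K k = {j. j < n \<and> c (e j) = k}" for k
  have "two_partition H r n (K ` c ` S)"
    unfolding two_partition_def
  proof (intro conjI ballI impI)
    show "\<Union> (K ` c ` S) = {..<n}" using e_S by (auto simp: K_def)
    show "A \<noteq> {}" if "A \<in> K ` c ` S" for A using that S_e by (auto simp: K_def)
    show "A \<inter> B = {}" if "A \<in> K ` c ` S" "B \<in> K ` c ` S" "A \<noteq> B" for A B
      using that by (auto simp: K_def)
    fix v assume "v \<in> vecs r"
    then consider "v = 0" | "v \<in> S" | "\<exists>a\<in>S. \<exists>b\<in>S. c a \<noteq> c b \<and> v = a + b" using cov by blast
    then show "v = (\<lambda>_. 0) \<or> (\<exists>j<n. v = col H r j) \<or>
      (\<exists>A\<in>K ` c ` S. \<exists>B\<in>K ` c ` S. A \<noteq> B \<and> (\<exists>j\<in>A. \<exists>k\<in>B. v = colsum H r {j, k}))"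
    proof cases
      case 1
      then show ?thesis by (simp add: zero_fun_def)
    next
      case 2
      then show ?thesis using S_e col by metis
    next
      case 3
      then obtain j k where jk: "j < n" "k < n" "c (e j) \<noteq> c (e k)" "v = e j + e k" using S_e by metis
      then have "j \<in> K (c (e j))" "k \<in> K (c (e k))" by (auto simp: K_def)
      moreover from this jk have "K (c (e j)) \<noteq> K (c (e k))" by (auto simp: K_def)
      moreover have "v = colsum H r {j, k}" using pair jk by metis
      moreover have "K (c (e j)) \<in> K ` c ` S" "K (c (e k)) \<in> K ` c ` S" using e_S jk by blast+
      ultimately show ?thesis by blast
    qed
  qed
  moreover have "card (K ` c ` S) \<le> p"
    using card_image_le[of "c ` S" K] \<open>finite S\<close> colours by simp
  ultimately show ?thesis using code by blast
qed

section \<open>The initial code\<close>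

definition tails :: "bit \<Rightarrow> bit list list \<Rightarrow> bit list list" where
  "tails a xs = map tl (filter (\<lambda>x. hd x = a) xs)"

lemma tails_simps:
  "tails a [] = []"
  "tails 0 ((0 # x) # xs) = x # tails 0 xs"
  "tails 0 ((1 # x) # xs) = tails 0 xs"
  "tails 1 ((0 # x) # xs) = tails 1 xs"
  "tails 1 ((1 # x) # xs) = x # tails 1 xs"
  by (simp_all add: tails_def)

fun covers :: "nat \<Rightarrow> bit list list \<Rightarrow> bool" where
  "covers 0 xs \<longleftrightarrow> xs \<noteq> []"
| "covers (Suc d) xs \<longleftrightarrow> covers d (tails 0 xs) \<and> covers d (tails 1 xs)"

lemma covers_imp_mem:
  assumes "covers d xs" "\<forall>x\<in>set xs. length x = d" "length v = d"
  shows "v \<in> set xs"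
  using assms
proof (induction d arbitrary: xs v)
  case 0
  then show ?case by (cases xs) auto
next
  case (Suc d)
  from Suc.prems(3) obtain a w where v: "v = a # w" "length w = d" by (cases v) auto
  have "covers d (tails a xs)"
    using Suc.prems(1) by (cases a) auto
  moreover have "\<forall>x\<in>set (tails a xs). length x = d"
    using Suc.prems(2) by (auto simp: tails_def)
  ultimately have "w \<in> set (tails a xs)"
    using Suc.IH v(2) by blast
  then obtain x where "x \<in> set xs" "hd x = a" "tl x = w" by (auto simp: tails_def)
  moreover have "x \<noteq> []" using Suc.prems(2) \<open>x \<in> set xs\<close> by auto
  ultimately show ?case using v(1) by (cases x) auto
qed

definition add_list :: "bit list \<Rightarrow> bit list \<Rightarrow> bit list" where
  "add_list = map2 (+)"

lemma add_list_simps: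
  "add_list [] [] = []"
  "add_list (0 # x) (0 # y) = 0 # add_list x y"
  "add_list (0 # x) (1 # y) = 1 # add_list x y"
  "add_list (1 # x) (0 # y) = 1 # add_list x y"
  "add_list (1 # x) (1 # y) = 0 # add_list x y"
  by (simp_all add: add_list_def)

fun cross_sums :: "bit list list list \<Rightarrow> bit list list" where
  "cross_sums [] = []"
| "cross_sums (A # L) = concat (map (\<lambda>a. map (add_list a) (concat L)) A) @ cross_sums L"

lemma cross_sumsD:
  "x \<in> set (cross_sums L) \<Longrightarrow>
     \<exists>i j a b. i < j \<and> j < length L \<and> a \<in> set (L ! i) \<and> b \<in> set (L ! j) \<and> x = add_list a b"
proof (induction L)
  case (Cons A L)
  from Cons.prems consider a B b where "a \<in> set A" "B \<in> set L" "b \<in> set B" "x = add_list a b"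
    | "x \<in> set (cross_sums L)" by auto
  then show ?case
  proof cases
    case 1
    then obtain j where "j < length L" "B = L ! j" by (metis in_set_conv_nth)
    with 1 show ?thesis
      by (intro exI[of _ 0] exI[of _ "Suc j"] exI[of _ a] exI[of _ b]) auto
  next
    case 2
    then obtain i j a b where "i < j" "j < length L" "a \<in> set (L ! i)" "b \<in> set (L ! j)"
      "x = add_list a b" using Cons.IH by blast
    then show ?thesis
      by (intro exI[of _ "Suc i"] exI[of _ "Suc j"] exI[of _ a] exI[of _ b]) auto
  qed
qed simp

definition vec_of_list :: "bit list \<Rightarrow> nat \<Rightarrow> bit" where
  "vec_of_list x = (\<lambda>i. if i < length x then x ! i else 0)"

lemma vec_of_list_in_vecs: "length x = r \<Longrightarrow> vec_of_list x \<in> vecs r"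
  by (auto simp: vec_of_list_def vecs_def)

lemma vec_of_list_eq_iff: "length x = length y \<Longrightarrow> vec_of_list x = vec_of_list y \<longleftrightarrow> x = y"
  unfolding vec_of_list_def fun_eq_iff by (auto intro: nth_equalityI)

lemma vec_of_list_zero: "vec_of_list (replicate r 0) = 0"
  by (auto simp: vec_of_list_def fun_eq_iff)

lemma vec_of_list_map2: "length x = length y \<Longrightarrow> vec_of_list (add_list x y) = vec_of_list x + vec_of_list y"
  by (auto simp: vec_of_list_def add_list_def fun_eq_iff)

lemma vecs_vec_of_listE:
  assumes "v \<in> vecs r"
  obtains x where "length x = r" "v = vec_of_list x"
proof
  show "length (map v [0..<r]) = r" "v = vec_of_list (map v [0..<r])"
    using assms by (auto simp: vec_of_list_def vecs_def fun_eq_iff)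
qed

lemma distinct_concat_nth_disjoint:
  assumes "distinct (concat L)" "i < length L" "k < length L" "i \<noteq> k"
  shows "set (L ! i) \<inter> set (L ! k) = {}"
  using assms
proof (induction L arbitrary: i k)
  case (Cons A L)
  have disj: "set A \<inter> set (L ! j) = {}" if "j < length L" for j
    using Cons.prems(1) nth_mem[OF that] by auto
  have "distinct (concat L)" using Cons.prems(1) by simp
  then show ?case
    using Cons.prems(2-4) Cons.IH disj by (cases i; cases k) (simp_all add: Int_commute)
qed simp

lemma partitioned_covering_of_lists:
  assumes len: "list_all (list_all (\<lambda>x. length x = r)) L"
    and dist: "distinct (replicate r 0 # concat L)"
    and cov: "covers r (replicate r 0 # concat L @ cross_sums L)"
    and line: "i < length L" "j < length L" "i \<noteq> j" "a \<in> set (L ! i)" "b \<in> set (L ! j)"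
      "add_list a b \<in> set (concat L)"
  shows "partitioned_covering r (length (concat L)) (length L)"
proof -
  let ?S = "vec_of_list ` set (concat L)"
  define c where "c v = {i. i < length L \<and> v \<in> vec_of_list ` set (L ! i)}" for v
  have len': "length x = r" if "x \<in> set (concat L)" for x
    using len that by (auto simp: list_all_iff)
  have mem: "x \<in> set (concat L)" if "i < length L" "x \<in> set (L ! i)" for i x
    using that by auto
  have inj: "inj_on vec_of_list (set (concat L))"
    using len' by (simp add: inj_on_def vec_of_list_eq_iff)
  have c: "c (vec_of_list x) = {i}" if x: "i < length L" "x \<in> set (L ! i)" for i x
  proof -
    have "k = i" if k: "k < length L" "vec_of_list x \<in> vec_of_list ` set (L ! k)" for k
    proof (rule ccontr)
      assume "k \<noteq> i"
      obtain y where y: "y \<in> set (L ! k)" "vec_of_list x = vec_of_list y" using k(2) by blast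
      then have "x = y" using inj mem x k(1) by (meson inj_onD)
      then have "x \<in> set (L ! i) \<inter> set (L ! k)" using x y by blast
      moreover have "set (L ! i) \<inter> set (L ! k) = {}"
        using distinct_concat_nth_disjoint[OF _ x(1) k(1)] \<open>k \<noteq> i\<close> dist by simp
      ultimately show False by blast
    qed
    then show ?thesis using x unfolding c_def by blast
  qed
  have cross: "c (vec_of_list x) \<noteq> c (vec_of_list y) \<and> vec_of_list x \<in> ?S \<and> vec_of_list y \<in> ?S \<and>
      vec_of_list (add_list x y) = vec_of_list x + vec_of_list y"
    if "i < length L" "j < length L" "i \<noteq> j" "x \<in> set (L ! i)" "y \<in> set (L ! j)" for i j x y
    using that mem[OF that(1,4)] mem[OF that(2,5)] c len' by (auto simp: vec_of_list_map2)
  show ?thesis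
  proof (rule partitioned_coveringI[where S = ?S and c = c])
    have "replicate r 0 \<notin> set (concat L)" using dist by (simp del: set_concat)
    then have "vec_of_list x \<noteq> 0" if "x \<in> set (concat L)" for x
      using that len'[OF that] vec_of_list_eq_iff[of x "replicate r 0"]
      by (auto simp: vec_of_list_zero simp del: set_concat)
    then show "?S \<subseteq> vecs r - {0}"
      using len' by (auto intro: vec_of_list_in_vecs simp del: set_concat)
    show "card ?S = length (concat L)"
      using dist by (simp add: card_image[OF inj] distinct_card del: set_concat)
    have "c ` ?S \<subseteq> (\<lambda>i. {i}) ` {..<length L}"
    proof
      fix k assume "k \<in> c ` ?S"
      then obtain A x where "A \<in> set L" "x \<in> set A" "k = c (vec_of_list x)" by auto
      then show "k \<in> (\<lambda>i. {i}) ` {..<length L}" using c by (auto simp: in_set_conv_nth)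
    qed
    then show "card (c ` ?S) \<le> length L"
      using surj_card_le[of "{..<length L}"] by simp
  next
    fix v assume v: "v \<in> vecs r" "v \<noteq> 0" "v \<notin> ?S"
    obtain x where x: "length x = r" "v = vec_of_list x" using vecs_vec_of_listE v(1) by blast
    have "length y = r" if "y \<in> set (cross_sums L)" for y
    proof -
      obtain i j a b where "i < j" "j < length L" "a \<in> set (L ! i)" "b \<in> set (L ! j)"
        "y = add_list a b" using cross_sumsD \<open>y \<in> set (cross_sums L)\<close> by blast
      then show ?thesis using len' mem[of i a] mem[of j b] by (simp add: add_list_def)
    qed
    then have "x \<in> set (replicate r 0 # concat L @ cross_sums L)"
      using len' x(1) by (intro covers_imp_mem[OF cov]) (auto simp del: set_concat)
    moreover have "x \<noteq> replicate r 0" using v(2) x(2) vec_of_list_zero by metis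
    moreover have "x \<notin> set (concat L)" using v(3) x(2) by blast
    ultimately have "x \<in> set (cross_sums L)" by simp
    then obtain i j a b where ij: "i < j" "j < length L" and ab: "a \<in> set (L ! i)" "b \<in> set (L ! j)"
      "x = add_list a b" using cross_sumsD by blast
    have "i < length L" "i \<noteq> j" using ij by auto
    from cross[OF this(1) ij(2) this(2) ab(1,2)] show "\<exists>a\<in>?S. \<exists>b\<in>?S. c a \<noteq> c b \<and> v = a + b"
      unfolding x(2) ab(3) by blast
  next
    show "\<exists>a\<in>?S. \<exists>b\<in>?S. c a \<noteq> c b \<and> a + b \<in> ?S"
      using cross[OF line(1-5)] line(6) by (metis imageI)
  qed
qed

text \<open>
  Found by a computer search among the sets that are invariant under a linear map of order 6; the
  inner lists are the classes of a 2-partition.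
\<close>
definition columns51 :: "bit list list list" where
  "columns51 =
   [[[1,0,0,0,0,0,0,0,0,0]],
    [[0,1,0,0,0,0,0,0,0,0], [1,1,0,0,0,0,0,0,0,0], [1,1,0,1,0,0,0,0,0,0], [0,1,1,0,0,0,0,0,0,1]],
    [[0,0,1,0,0,0,0,0,0,0], [0,1,1,1,0,0,0,0,0,0]],
    [[1,1,1,0,0,0,0,0,0,0], [1,0,1,1,0,0,0,0,0,0]],
    [[0,0,0,1,0,0,0,0,0,0], [0,0,0,0,0,0,0,0,0,1]],
    [[0,0,0,0,1,0,0,0,0,0], [0,0,0,0,1,1,0,0,0,0], [0,0,1,1,0,1,0,0,1,0], [1,0,0,1,0,1,0,0,1,1]],
    [[0,0,0,0,0,1,0,0,0,0], [1,1,0,1,0,0,1,1,1,0], [0,0,1,0,1,0,1,1,1,0], [0,1,1,1,1,1,1,1,1,0],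
     [0,0,0,1,0,1,1,1,1,1], [1,1,1,0,1,1,1,1,1,1]],
    [[0,0,0,0,0,0,1,0,0,0], [0,0,1,1,1,0,1,0,0,0], [1,0,1,0,0,1,1,0,0,0], [1,1,1,1,0,1,0,0,0,1],
     [0,0,1,1,1,0,1,0,0,1], [1,0,0,1,1,1,1,0,0,1]],
    [[1,0,0,1,1,1,1,0,0,0], [0,0,0,0,0,0,1,0,0,1]],
    [[0,0,0,0,0,0,0,1,0,0], [1,1,1,1,0,0,0,0,0,1], [0,1,1,0,1,1,0,0,0,1], [0,0,1,1,0,0,0,1,0,1],
     [0,1,0,1,0,1,0,1,0,1]],
    [[1,0,0,1,1,0,0,1,0,0], [0,1,1,0,0,1,0,1,0,0], [1,1,1,1,1,1,0,1,0,0], [1,1,0,0,1,1,0,1,0,1]],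
    [[0,0,0,0,0,0,0,0,1,0], [0,1,1,0,1,0,0,0,1,0]],
    [[0,1,0,1,1,1,0,0,1,0], [1,0,1,0,0,0,0,0,1,1], [1,1,0,0,1,0,0,0,1,1], [1,1,1,1,1,1,0,0,1,1]],
    [[1,0,0,0,0,1,1,1,1,0], [0,1,0,1,1,0,0,0,0,1], [0,1,0,0,0,0,1,1,1,1], [1,0,1,1,1,0,1,1,1,1]],
    [[0,1,0,1,0,0,0,0,0,1], [1,0,1,0,1,0,0,1,0,1]],
    [[1,0,1,0,0,1,1,0,0,1]]]"

lemma partitioned_covering_10: "partitioned_covering 10 51 16"
proof -
  have L: "list_all (list_all (\<lambda>x. length x = 10)) columns51"
    "distinct (replicate 10 0 # concat columns51)" "length columns51 = 16" "length (concat columns51) = 51"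
    by code_simp+
  have ten: "10 = Suc (Suc (Suc (Suc (Suc (Suc (Suc (Suc (Suc (Suc 0)))))))))" by simp
  have cov: "covers 10 (replicate 10 0 # concat columns51 @ cross_sums columns51)"
    by (simp only: ten columns51_def cross_sums.simps concat.simps append.simps list.map
        add_list_simps replicate.simps covers.simps tails_simps list.distinct not_False_eq_True simp_thms)
  let ?a = "[1,0,0,0,0,0,0,0,0,0]" and ?b = "[0,1,0,0,0,0,0,0,0,0]"
  have "?a \<in> set (columns51 ! 0)" "?b \<in> set (columns51 ! 1)" "add_list ?a ?b \<in> set (concat columns51)"
    by code_simp+
  then have "partitioned_covering 10 (length (concat columns51)) (length columns51)"
    using L by (intro partitioned_covering_of_lists[OF L(1,2) cov, of 0 1 ?a ?b]) simp_all
  then show ?thesis by (simp only: L)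
qed

section \<open>The infinite family\<close>

definition family_length :: "nat \<Rightarrow> nat" where
  "family_length t = 26 * 2 ^ (t - 4) - 1"

lemma partitioned_covering_family_step:
  assumes "partitioned_covering (2 * s) (family_length s) p"
    and "s \<ge> 4" "0 < m" "p \<le> 2 ^ m" "m \<le> s"
  shows "partitioned_covering (2 * (s + m)) (family_length (s + m)) (2 ^ (m + 1))"
proof -
  obtain k where s: "s = 4 + k" using \<open>s \<ge> 4\<close> le_Suc_ex by blast
  have "(2 :: nat) ^ m \<le> 2 ^ (4 + k)" using assms(5) s by (intro power_increasing) auto
  also have "\<dots> \<le> 26 * 2 ^ k - 1"
    using one_le_power[of "2 :: nat" k] by (simp add: power_add)
  finally have "2 ^ m \<le> family_length s" by (simp add: family_length_def s)
  from partitioned_covering_concatenation[OF assms(1,3,4) this]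
  have "partitioned_covering (2 * s + 2 * m) (family_length s * 2 ^ m + 2 ^ m - 1) (2 ^ (m + 1))" .
  moreover have "family_length s * 2 ^ m + 2 ^ m - 1 = family_length (s + m)"
  proof -
    have "family_length s + 1 = 26 * 2 ^ k"
      using one_le_power[of "2 :: nat" k] unfolding family_length_def s by simp
    then have "family_length s * 2 ^ m + 2 ^ m = 26 * 2 ^ k * 2 ^ m"
      by (metis add_mult_distrib mult_1)
    also have "\<dots> = 26 * 2 ^ (k + m)" by (simp add: power_add)
    finally show ?thesis by (simp add: family_length_def s)
  qed
  ultimately show ?thesis by (simp add: algebra_simps)
qed

lemma partitioned_covering_18: "partitioned_covering (2 * 9) (family_length 9) 32"
  using partitioned_covering_family_step[of 5 16 4] partitioned_covering_10
  by (simp add: family_length_def)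

lemma partitioned_covering_20: "partitioned_covering (2 * 10) (family_length 10) 64"
  using partitioned_covering_family_step[of 5 16 5] partitioned_covering_10
  by (simp add: family_length_def)

text \<open>
  For \<open>t \<ge> 21\<close> the construction is applied with \<open>m = t div 2 - 3\<close> to the member \<open>s = t - m\<close> of the
  family, which requires at most \<open>2^m\<close> classes there, and \<open>2^(s - 7) \<le> 2^m\<close>.
\<close>
lemma partitioned_covering_family:
  assumes "t \<ge> 14"
  shows "partitioned_covering (2 * t) (family_length t) (if t < 21 then 2 ^ (t - 7) else 2 ^ (t div 2 - 2))"
  using assms
proof (induction t rule: less_induct)
  case (less t)
  consider "t \<le> 18" | "t = 19 \<or> t = 20" | "t \<ge> 21" by linarith
  then show ?case
  proof cases
    case 1
    define m where "m = t - 9"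
    have t: "t = 9 + m" and m: "5 \<le> m" "m \<le> 9" using 1 less.prems by (auto simp: m_def)
    have "(32 :: nat) \<le> 2 ^ m" using power_increasing[OF m(1), of "2 :: nat"] by simp
    then have "partitioned_covering (2 * t) (family_length t) (2 ^ (m + 1))"
      using partitioned_covering_family_step[OF partitioned_covering_18, of m] m unfolding t by simp
    then show ?thesis
      by (rule partitioned_covering_mono) (use 1 t m in \<open>auto intro: power_increasing\<close>)
  next
    case 2
    define m where "m = t - 10"
    have t: "t = 10 + m" and m: "9 \<le> m" "m \<le> 10" using 2 by (auto simp: m_def)
    have "(64 :: nat) \<le> 2 ^ m" using power_increasing[OF m(1), of "2 :: nat"] by simp
    then have "partitioned_covering (2 * t) (family_length t) (2 ^ (m + 1))"
      using partitioned_covering_family_step[OF partitioned_covering_20, of m] m unfolding t by simp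
    then show ?thesis
      by (rule partitioned_covering_mono) (use 2 t m in \<open>auto intro: power_increasing\<close>)
  next
    case 3
    define m where "m = t div 2 - 3"
    define s where "s = t - m"
    have t: "t = s + m" and m: "0 < m" "m \<le> s" and s: "14 \<le> s" "s < t" "s - 7 \<le> m" "s div 2 - 2 \<le> m"
      using 3 by (auto simp: m_def s_def)
    have "(if s < 21 then 2 ^ (s - 7) else 2 ^ (s div 2 - 2)) \<le> (2 :: nat) ^ m"
      using s by (auto intro: power_increasing)
    then have "partitioned_covering (2 * t) (family_length t) (2 ^ (m + 1))"
      using partitioned_covering_family_step[OF less.IH[OF s(2,1)]] m s(1) unfolding t by simp
    moreover have "m + 1 = t div 2 - 2" using 3 by (simp add: m_def)
    ultimately show ?thesis using 3 by (simp only: not_less[symmetric] if_False)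
  qed
qed

lemma family_length_less: "t \<ge> 4 \<Longrightarrow> family_length t + 1 < 2 ^ (2 * t)"
proof -
  assume "t \<ge> 4"
  then obtain k where t: "t = 4 + k" using le_Suc_ex by blast
  have "26 * 2 ^ k * 1 < (2 :: nat) ^ 8 * 2 ^ k * 2 ^ k"
    by (intro mult_less_le_imp_less) simp_all
  also have "\<dots> = 2 ^ (2 * t)" unfolding t mult_2 power_add by simp
  finally show ?thesis using one_le_power[of "2 :: nat" k] by (simp add: family_length_def t)
qed

lemma covering_density_tendsto:
  "(\<lambda>t. (1 + real (family_length t) + real (family_length t choose 2)) / 2 ^ (2 * t)) \<longlonglongrightarrow> 26\<^sup>2 / 2 ^ 9"
proof (rule LIMSEQ_offset[where k = 4])
  have eq: "(1 + real (family_length (t + 4)) + real (family_length (t + 4) choose 2)) / 2 ^ (2 * (t + 4)) =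
      26\<^sup>2 / 2 ^ 9 - 26 / 2 ^ 9 * (1 / 2) ^ t + 1 / 2 ^ 8 * ((1 / 2) ^ t * (1 / 2) ^ t)" for t
  proof -
    define q where "q = (2 :: real) ^ t"
    have q: "q \<ge> 1" by (simp add: q_def)
    have n: "real (family_length (t + 4)) = 26 * q - 1"
      using one_le_power[of "2 :: nat" t] by (simp add: family_length_def q_def of_nat_diff)
    have "2 * (family_length (t + 4) choose 2) = family_length (t + 4) * (family_length (t + 4) - 1)"
      unfolding choose_two by (intro dvd_mult_div_cancel) (auto simp: even_diff_nat)
    then have "2 * real (family_length (t + 4) choose 2) = real (family_length (t + 4)) * real (family_length (t + 4) - 1)"
      by (metis of_nat_mult of_nat_numeral)
    moreover have "real (family_length (t + 4) - 1) = 26 * q - 2"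
      using n q by (subst of_nat_diff) linarith+
    ultimately have "2 * real (family_length (t + 4) choose 2) = (26 * q - 1) * (26 * q - 2)"
      by (simp only: n)
    then have "1 + real (family_length (t + 4)) + real (family_length (t + 4) choose 2) = 338 * (q * q) - 13 * q + 1"
      unfolding n by (simp add: algebra_simps)
    moreover have "(2 :: real) ^ (2 * (t + 4)) = 256 * (q * q)"
      unfolding q_def mult_2 power_add by simp
    moreover have "(1 / 2 :: real) ^ t = 1 / q" by (simp add: q_def power_one_over)
    moreover have "(338 * (q * q) - 13 * q + 1) / (256 * (q * q)) =
        26\<^sup>2 / 2 ^ 9 - 26 / 2 ^ 9 * (1 / q) + 1 / 2 ^ 8 * (1 / q * (1 / q))"
    proof -
      have "q \<noteq> 0" using q by simp
      then show ?thesis by (simp add: add_divide_distrib diff_divide_distrib)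
    qed
    ultimately show ?thesis by (simp only:)
  qed
  have lim: "(\<lambda>t. (1 / 2 :: real) ^ t) \<longlonglongrightarrow> 0" by (rule LIMSEQ_power_zero) simp
  have "(\<lambda>t. 26\<^sup>2 / 2 ^ 9 - 26 / 2 ^ 9 * (1 / 2) ^ t + 1 / 2 ^ 8 * ((1 / 2) ^ t * (1 / 2) ^ t))
      \<longlonglongrightarrow> (26\<^sup>2 / 2 ^ 9 - 26 / 2 ^ 9 * 0 + 1 / 2 ^ 8 * (0 * 0) :: real)"
    by (intro tendsto_intros lim)
  then show "(\<lambda>t. (1 + real (family_length (t + 4)) + real (family_length (t + 4) choose 2)) / 2 ^ (2 * (t + 4)))
      \<longlonglongrightarrow> 26\<^sup>2 / 2 ^ 9"
    unfolding eq by simp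
qed

theorem theorem5p7:
  shows "(\<forall>r::nat. even r \<and> (r \<in> {10, 18, 20} \<or> r \<ge> 28) \<longrightarrow>
            (let n = 26 * 2 ^ (r div 2 - 4) - 1 in
              (\<exists>H. is_code H r n 3 2 \<and>
                  (r \<ge> 42 \<longrightarrow> (\<exists>P. two_partition H r n P \<and> card P \<le> 2 ^ (r div 4 - 2) + 1)))
              \<and> ell2 r 2 \<le> n))
       \<and> ((\<lambda>t::nat. let r = 2 * t; n = 26 * 2 ^ (t - 4) - 1 :: nat in
              (1 + real n + real (n choose 2)) / 2 ^ r)
            \<longlonglongrightarrow> 26 ^ 2 / 2 ^ 9)"
proof (intro conjI allI impI)
  fix r :: nat
  assume r: "even r \<and> (r \<in> {10, 18, 20} \<or> r \<ge> 28)"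
  then obtain t where t: "r = 2 * t" by (auto elim: evenE)
  have "t = 5 \<or> t = 9 \<or> t = 10 \<or> t \<ge> 14" using r t by auto
  then have "\<exists>p. partitioned_covering r (family_length t) p \<and> (r \<ge> 42 \<longrightarrow> p \<le> 2 ^ (r div 4 - 2) + 1)"
  proof (elim disjE)
    assume "t = 5"
    then show ?thesis using partitioned_covering_10 by (auto simp: t family_length_def)
  next
    assume "t = 9"
    then show ?thesis using partitioned_covering_18 by (auto simp: t)
  next
    assume "t = 10"
    then show ?thesis using partitioned_covering_20 by (auto simp: t)
  next
    assume "t \<ge> 14"
    moreover have "r div 4 = t div 2" by (simp add: t)
    ultimately show ?thesis using partitioned_covering_family[of t] t by fastforce
  qed
  then obtain p where p: "partitioned_covering r (family_length t) p" "r \<ge> 42 \<longrightarrow> p \<le> 2 ^ (r div 4 - 2) + 1"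
    by blast
  have "t \<ge> 4" using r t by auto
  from code_if_partitioned_covering[OF p(1)] family_length_less[OF this] t
  obtain H P where HP: "is_code H r (family_length t) 3 2" "two_partition H r (family_length t) P" "card P \<le> p"
    by blast
  have "ell2 r 2 \<le> family_length t"
    unfolding ell2_def using HP(1) by (intro Least_le) (auto simp: is_code_def)
  have n: "26 * 2 ^ (r div 2 - 4) - 1 = family_length t" by (simp add: family_length_def t)
  show "let n = 26 * 2 ^ (r div 2 - 4) - 1 in
      (\<exists>H. is_code H r n 3 2 \<and>
          (r \<ge> 42 \<longrightarrow> (\<exists>P. two_partition H r n P \<and> card P \<le> 2 ^ (r div 4 - 2) + 1)))
      \<and> ell2 r 2 \<le> n"
    unfolding Let_def n using HP p(2) \<open>ell2 r 2 \<le> family_length t\<close> le_trans by blast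
next
  show "(\<lambda>t::nat. let r = 2 * t; n = 26 * 2 ^ (t - 4) - 1 :: nat in
      (1 + real n + real (n choose 2)) / 2 ^ r) \<longlonglongrightarrow> 26 ^ 2 / 2 ^ 9"
    using covering_density_tendsto by (simp only: family_length_def Let_def)
qed

end
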